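(* Let $S$ be a Shrub and let $n=g^+(S)$ be its normal-play nim-value. Then for every combinatorial game $T$ (in the entire misère universe), $o^-(S+T)=o^-( *_n+T)$, where $*_n$ is a Stalk of height $n$ (a nim-heap of size $n$). That is, $S$ is equivalent under misère play, in the universe of all games, to a Stalk of height $g^+(S)$.
   Context: Hackenbush: a position is a finite graph with edges colored blue, red or green and a designated set of ground vertices; Left may cut blue or green edges, Right may cut red or green edges, and after each cut every component no longer connected to the ground is discarded. Under normal play the last player to move wins; under misère play the last player to move loses. A Stalk of height $n$ is a path of $n$ green edges with one endpoint on the ground; it is the nim-heap $*_n$. A Shrub is a rooted graph with all edges green whose root vertex has degree one and is the only ground vertex. The normal-play nim-value $g^+(G)$ of an impartial game is defined recursively as the least non-negative integer not equal to $g^+$ of any option of $G$ (so $g^+(0)=0$). $G+H$ denotes the disjunctive sum. $o^-(G)\in\{\mathcal N,\mathcal P,\mathcal L,\mathcal R\}$ is the misère outcome class of $G$ (next player wins, previous player wins, Left wins regardless of who starts, Right wins regardless of who starts). *)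

theory Defs
  imports "HOL-Library.FSet"
begin

section \<open>Games under misere play\<close>

text \<open>Short partizan games: finitely many options for either player, and all play sequences
  terminate.\<close>

datatype game = Game (left_opts: "game fset") (right_opts: "game fset")

lemma size_option_less [termination_simp]:
  "H |\<in>| left_opts G \<Longrightarrow> size H < size G"
  "H |\<in>| right_opts G \<Longrightarrow> size H < size G"
proof -
  have *: "size H < Suc (sum (Suc \<circ> size) (fset A) + m)"
    "size H < Suc (m + sum (Suc \<circ> size) (fset A))" if "H |\<in>| A" for A :: "game fset" and m
  proof -
    have "(Suc \<circ> size) H \<le> sum (Suc \<circ> size) (fset A)"
      using that by (intro member_le_sum) auto
    then show "size H < Suc (sum (Suc \<circ> size) (fset A) + m)"
      "size H < Suc (m + sum (Suc \<circ> size) (fset A))" by auto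
  qed
  show "H |\<in>| left_opts G \<Longrightarrow> size H < size G"
    "H |\<in>| right_opts G \<Longrightarrow> size H < size G"
    using * by (cases G; auto simp: size_fset_overloaded_simps comp_def)+
qed

instantiation game :: plus
begin

function plus_game :: "game \<Rightarrow> game \<Rightarrow> game" where
  "plus_game G H =
     Game ((\<lambda>G'. plus_game G' H) |`| left_opts G |\<union>| (\<lambda>H'. plus_game G H') |`| left_opts H)
          ((\<lambda>G'. plus_game G' H) |`| right_opts G |\<union>| (\<lambda>H'. plus_game G H') |`| right_opts H)"
  by auto
termination
  by (relation "measure (\<lambda>(G, H). size G + size H)") (auto simp: size_option_less)

declare plus_game.simps [simp del]

instance ..

end

text \<open>The nim-value is meaningful for impartial games only, that is, if the left and the right
  options of every subposition coincide; there the union below is just the set of options.\<close>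

function nim_value :: "game \<Rightarrow> nat" where
  "nim_value G = (LEAST n. n |\<notin>| nim_value |`| (left_opts G |\<union>| right_opts G))"
  by auto
termination
  by (relation "measure size") (auto simp: size_option_less)

declare nim_value.simps [simp del]

datatype player = Left | Right

fun opponent :: "player \<Rightarrow> player" where
  "opponent Left = Right"
| "opponent Right = Left"

fun options :: "player \<Rightarrow> game \<Rightarrow> game fset" where
  "options Left G = left_opts G"
| "options Right G = right_opts G"

lemma size_options_less: "H |\<in>| options p G \<Longrightarrow> size H < size G"
  by (cases p) (auto simp: size_option_less)

text \<open>Misere play: a player who cannot move wins.\<close>

function misere_wins_first :: "player \<Rightarrow> game \<Rightarrow> bool" where
  "misere_wins_first p G \<longleftrightarrow>
     options p G = {||} \<or> (\<exists>G' |\<in>| options p G. \<not> misere_wins_first (opponent p) G')"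
  by auto
termination
  by (relation "measure (\<lambda>(p, G). size G)") (auto simp: size_options_less)

declare misere_wins_first.simps [simp del]

datatype outcome = outcome_N | outcome_P | outcome_L | outcome_R

definition misere_outcome :: "game \<Rightarrow> outcome" where
  "misere_outcome G =
     (if misere_wins_first Left G
      then (if misere_wins_first Right G then outcome_N else outcome_L)
      else (if misere_wins_first Right G then outcome_R else outcome_P))"

section \<open>Hackenbush\<close>

datatype colour = Blue | Red | Green

text \<open>Multigraphs: parallel edges and loops are allowed; \<open>ends e\<close> is a singleton if \<open>e\<close> is a loop.\<close>

record ('v, 'e) hackenbush =
  verts :: "'v set"
  edges :: "'e set"
  ends :: "'e \<Rightarrow> 'v set"
  colour_of :: "'e \<Rightarrow> colour"
  ground :: "'v set"

definition grounded_verts :: "('v, 'e) hackenbush \<Rightarrow> 'v set" where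
  "grounded_verts P =
     {v \<in> verts P. \<exists>g \<in> ground P. (g, v) \<in> {(u, w). \<exists>e \<in> edges P. ends P e = {u, w}}\<^sup>*}"

definition hackenbush_position :: "('v, 'e) hackenbush \<Rightarrow> bool" where
  "hackenbush_position P \<longleftrightarrow>
     finite (verts P) \<and> finite (edges P) \<and>
     (\<forall>e \<in> edges P. ends P e \<subseteq> verts P \<and> card (ends P e) \<in> {1, 2}) \<and>
     ground P \<subseteq> verts P \<and> grounded_verts P = verts P"

definition discard_ungrounded :: "('v, 'e) hackenbush \<Rightarrow> ('v, 'e) hackenbush" where
  "discard_ungrounded P =
     P\<lparr>verts := grounded_verts P, edges := {e \<in> edges P. ends P e \<subseteq> grounded_verts P}\<rparr>"

definition cut_edge :: "('v, 'e) hackenbush \<Rightarrow> 'e \<Rightarrow> ('v, 'e) hackenbush" where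
  "cut_edge P e = discard_ungrounded (P\<lparr>edges := edges P - {e}\<rparr>)"

lemma edges_cut_edge: "edges (cut_edge P e) \<subseteq> edges P - {e}"
  by (auto simp: cut_edge_def discard_ungrounded_def)

fun may_cut :: "player \<Rightarrow> colour \<Rightarrow> bool" where
  "may_cut Left c \<longleftrightarrow> c \<in> {Blue, Green}"
| "may_cut Right c \<longleftrightarrow> c \<in> {Red, Green}"

definition cuttable :: "player \<Rightarrow> ('v, 'e) hackenbush \<Rightarrow> 'e set" where
  "cuttable p P = {e \<in> edges P. may_cut p (colour_of P e)}"

text \<open>The case of infinitely many edges is irrelevant and only serves to make the recursion
  terminate.\<close>

function hackenbush_game :: "('v, 'e) hackenbush \<Rightarrow> game" where
  "hackenbush_game P =
     (if finite (edges P)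
      then Game ((\<lambda>e. hackenbush_game (cut_edge P e)) |`| Abs_fset (cuttable Left P))
                ((\<lambda>e. hackenbush_game (cut_edge P e)) |`| Abs_fset (cuttable Right P))
      else Game {||} {||})"
  by auto
termination
proof (relation "measure (\<lambda>P. card (edges P))", goal_cases)
  case (2 P e)
  then have "e \<in> edges P"
    by (auto simp: cuttable_def Abs_fset_inverse)
  then show ?case
    using 2 edges_cut_edge[of P e] by (auto intro!: psubset_card_mono)
next
  case (3 P e)
  then have "e \<in> edges P"
    by (auto simp: cuttable_def Abs_fset_inverse)
  then show ?case
    using 3 edges_cut_edge[of P e] by (auto intro!: psubset_card_mono)
qed auto

declare hackenbush_game.simps [simp del]

definition degree :: "('v, 'e) hackenbush \<Rightarrow> 'v \<Rightarrow> nat" where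
  "degree P v = (\<Sum>e \<in> {e \<in> edges P. v \<in> ends P e}. if ends P e = {v} then 2 else 1)"

definition shrub :: "('v, 'e) hackenbush \<Rightarrow> bool" where
  "shrub S \<longleftrightarrow>
     hackenbush_position S \<and> (\<forall>e \<in> edges S. colour_of S e = Green) \<and>
     (\<exists>r. ground S = {r} \<and> degree S r = 1)"

definition stalk :: "nat \<Rightarrow> (nat, nat) hackenbush" where
  "stalk n = \<lparr>verts = {0..n}, edges = {0..<n}, ends = (\<lambda>i. {i, Suc i}),
     colour_of = (\<lambda>_. Green), ground = {0}\<rparr>"

lemma cut_edge_stalk:
  assumes "i < n"
  shows "cut_edge (stalk n) i = stalk i"
proof -
  define R where "R = {(u, w). \<exists>e \<in> {0..<n} - {i}. {e, Suc e} = {u, w}}"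
  have low: "(0, v) \<in> R\<^sup>*" if "v \<le> i" for v
    using that
  proof (induction v)
    case (Suc v)
    then have "(v, Suc v) \<in> R"
      using assms unfolding R_def mem_Collect_eq prod.case
      by (intro bexI[of _ v]) simp_all
    with Suc show ?case
      by (meson Suc_leD rtrancl.rtrancl_into_rtrancl)
  qed auto
  have high: "v \<le> i" if "(0, v) \<in> R\<^sup>*" for v
    using that
  proof (induction rule: rtrancl_induct)
    case (step u w)
    from step(2) obtain e where "e \<noteq> i" "{e, Suc e} = {u, w}"
      unfolding R_def by blast
    with step(3) show ?case
      by (auto simp only: doubleton_eq_iff)
  qed auto
  let ?P = "(stalk n)\<lparr>edges := edges (stalk n) - {i}\<rparr>"
  have "grounded_verts ?P = {v \<in> {0..n}. (0, v) \<in> R\<^sup>*}"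
    by (simp add: grounded_verts_def stalk_def R_def)
  also have "\<dots> = {0..i}"
    using low high order.trans[OF _ less_imp_le[OF assms]]
    unfolding set_eq_iff mem_Collect_eq atLeastAtMost_iff by blast
  finally have *: "grounded_verts ?P = {0..i}" .
  have "{e \<in> edges ?P. ends ?P e \<subseteq> {0..i}} = {0..<i}"
    using assms by (auto simp: stalk_def)
  then show ?thesis
    unfolding cut_edge_def discard_ungrounded_def * by (simp add: stalk_def)
qed

text \<open>A Stalk is the corresponding nim-heap.\<close>

lemma hackenbush_game_stalk:
  "hackenbush_game (stalk n) =
     Game ((\<lambda>i. hackenbush_game (stalk i)) |`| Abs_fset {..<n})
          ((\<lambda>i. hackenbush_game (stalk i)) |`| Abs_fset {..<n})"
proof -
  have fin: "finite (edges (stalk n))"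
    by (simp add: stalk_def)
  have may: "may_cut p Green" for p
    by (cases p) auto
  have cuttable: "cuttable p (stalk n) = {..<n}" for p
    by (auto simp add: stalk_def cuttable_def may)
  have "(\<lambda>e. hackenbush_game (cut_edge (stalk n) e)) |`| Abs_fset {..<n} =
        (\<lambda>i. hackenbush_game (stalk i)) |`| Abs_fset {..<n}"
    by (intro fset.map_cong0) (simp add: Abs_fset_inverse cut_edge_stalk)
  with fin cuttable show ?thesis
    by (subst hackenbush_game.simps) simp
qed

end

(* Cutting the root edge of a shrub leaves nothing, and cutting any other edge leaves a shrub. So
   0 is an option of every shrub, and by induction every option is equivalent to a nim-heap. The
   mex rule holds for misere play against arbitrary games as soon as 0 is an option: neither the
   game nor the heap *n is then ever an end, so a move to a heap *k with k > n can be reversed to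
   *n as in normal play. *)
theory Submission
  imports Defs
begin

section \<open>The misere mex rule\<close>

text \<open>Asking for agreement for each player separately, rather than for equal outcomes, lets an
  induction follow one move at a time; \<open>misere_outcome\<close> depends only on these two truth
  values.\<close>

definition misere_equiv :: "game \<Rightarrow> game \<Rightarrow> bool" where
  "misere_equiv G H \<longleftrightarrow> (\<forall>p T. misere_wins_first p (G + T) \<longleftrightarrow> misere_wins_first p (H + T))"

lemma misere_equiv_refl: "misere_equiv G G"
  by (simp add: misere_equiv_def)

lemma misere_equivD:
  "misere_equiv G H \<Longrightarrow> misere_wins_first p (G + T) \<longleftrightarrow> misere_wins_first p (H + T)"
  by (simp add: misere_equiv_def)

lemma misere_outcome_cong: "misere_equiv G H \<Longrightarrow> misere_outcome (G + T) = misere_outcome (H + T)"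
  by (simp add: misere_equiv_def misere_outcome_def)

lemma options_plus:
  "options p (G + H) = (\<lambda>G'. G' + H) |`| options p G |\<union>| (\<lambda>H'. G + H') |`| options p H"
  by (cases p; subst plus_game.simps) simp_all

lemma options_stalk:
  "options p (hackenbush_game (stalk n)) = (\<lambda>i. hackenbush_game (stalk i)) |`| Abs_fset {..<n}"
  by (cases p; subst hackenbush_game_stalk) simp_all

lemma in_options_stalk_iff:
  "H |\<in>| options p (hackenbush_game (stalk n)) \<longleftrightarrow> (\<exists>i<n. H = hackenbush_game (stalk i))"
  by (auto simp: options_stalk Abs_fset_inverse)

lemma misere_wins_first_iff:
  assumes "options p G \<noteq> {||}"
  shows "misere_wins_first p G \<longleftrightarrow> (\<exists>G' |\<in>| options p G. \<not> misere_wins_first (opponent p) G')"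
  using assms by (subst misere_wins_first.simps) simp

text \<open>An option of \<open>G\<close> for \<open>p\<close> keeps every sum \<open>G + T\<close>
  from being an end for \<open>p\<close>. The misere clause "no move wins" thus never fires, and
  winning reduces to finding a good move, as in normal play.\<close>

lemma misere_wins_first_plus_iff:
  assumes "options p G \<noteq> {||}"
  shows "misere_wins_first p (G + T) \<longleftrightarrow>
    (\<exists>G' |\<in>| options p G. \<not> misere_wins_first (opponent p) (G' + T)) \<or>
    (\<exists>T' |\<in>| options p T. \<not> misere_wins_first (opponent p) (G + T'))"
proof -
  have "options p (G + T) \<noteq> {||}"
    using assms by (auto simp: options_plus)
  then show ?thesis
    unfolding misere_wins_first_iff[OF \<open>options p (G + T) \<noteq> {||}\<close>] by (auto simp: options_plus)
qed

lemma nim_value_mex: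
  shows nim_value_notin: "nim_value G \<notin> nim_value ` fset (left_opts G |\<union>| right_opts G)"
    and less_nim_value_in: "k < nim_value G \<Longrightarrow> k \<in> nim_value ` fset (left_opts G |\<union>| right_opts G)"
proof -
  let ?A = "nim_value ` fset (left_opts G |\<union>| right_opts G)"
  have eq: "nim_value G = (LEAST n. n \<notin> ?A)"
    by (subst nim_value.simps) simp
  have "\<exists>n. n \<notin> ?A"
    by (intro ex_new_if_finite) auto
  then show "nim_value G \<notin> ?A"
    unfolding eq by (rule LeastI_ex)
  show "k < nim_value G \<Longrightarrow> k \<in> ?A"
    unfolding eq using not_less_Least by blast
qed

text \<open>Moves in \<open>T\<close> match by induction on \<open>T\<close>. A move from
  \<open>G\<close> to \<open>H\<close> counts as a move to the heap of size
  \<open>nim_value H\<close>: below the mex it is also a move of the heap, and above the mex it is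
  reversible. Conversely, the mex property supplies an option of \<open>G\<close> for each smaller
  heap.\<close>

lemma misere_mex_rule:
  assumes opts: "left_opts G = A" "right_opts G = A"
    and equiv: "\<And>H. H |\<in>| A \<Longrightarrow> misere_equiv H (hackenbush_game (stalk (nim_value H)))"
    and zero: "0 \<in> nim_value ` fset A"
  shows "misere_equiv G (hackenbush_game (stalk (nim_value G)))"
proof -
  define n where "n = nim_value G"
  let ?heap = "\<lambda>k. hackenbush_game (stalk k)"
  have optG: "options p G = A" for p
    using opts by (cases p) auto
  have notin: "n \<notin> nim_value ` fset A" and below: "\<And>k. k < n \<Longrightarrow> k \<in> nim_value ` fset A"
    using nim_value_notin[of G] less_nim_value_in[of _ G] opts by (auto simp: n_def)
  \<comment> \<open>This is where \<open>zero\<close> enters: both \<open>G\<close> and the heap of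
    size \<open>n\<close> then have options for either player, so the move-by-move criterion applies
    to both, even if \<open>T\<close> is an end.\<close>
  have "n > 0"
    using zero notin by (metis gr0I)
  have neG: "options p G \<noteq> {||}" for p
    using zero by (auto simp: optG)
  have "?heap 0 |\<in>| options p (?heap n)" for p
    using \<open>n > 0\<close> by (auto simp: in_options_stalk_iff)
  then have neN: "options p (?heap n) \<noteq> {||}" for p
    by auto
  have "misere_wins_first p (G + T) \<longleftrightarrow> misere_wins_first p (?heap n + T)" for p T
  proof (induction "size T" arbitrary: p T rule: less_induct)
    case less
    have IH: "misere_wins_first q (G + T') \<longleftrightarrow> misere_wins_first q (?heap n + T')"
      if "T' |\<in>| options p T" for q T'
      using less that size_options_less by blast
    note winG = misere_wins_first_plus_iff[OF neG, of p T, unfolded optG]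
    note winN = misere_wins_first_plus_iff[OF neN, of p T]
    let ?loses = "\<lambda>H. \<not> misere_wins_first (opponent p) (H + T)"
    have *: "?loses H \<longleftrightarrow> ?loses (?heap (nim_value H))" if "H |\<in>| A" for H
      using misere_equivD[OF equiv[OF that]] by blast
    \<comment> \<open>The opponent could answer the move to the heap of size \<open>k\<close> by
      cutting it down to \<open>n\<close>. As the opponent loses there, this answer also fails,
      which says that \<open>p\<close> wins moving first on the heap of size \<open>n\<close> plus
      \<open>T\<close>.\<close>
    have reversible: "misere_wins_first p (?heap n + T)" if "n < k" "?loses (?heap k)" for k
    proof -
      have "?heap n |\<in>| options (opponent p) (?heap k)"
        using that by (auto simp: in_options_stalk_iff)
      moreover from this have "options (opponent p) (?heap k) \<noteq> {||}"
        by auto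
      moreover have "opponent (opponent p) = p"
        by (cases p) auto
      ultimately show ?thesis
        using that misere_wins_first_plus_iff by metis
    qed
    show ?case
    proof
      assume "misere_wins_first p (G + T)"
      then consider H where "H |\<in>| A" "?loses H"
        | T' where "T' |\<in>| options p T" "\<not> misere_wins_first (opponent p) (G + T')"
        unfolding winG by blast
      then show "misere_wins_first p (?heap n + T)"
      proof cases
        case 1
        with notin have "nim_value H \<noteq> n"
          by blast
        then consider "nim_value H < n" | "nim_value H > n"
          by linarith
        then show ?thesis
        proof cases
          case less: 1
          then have "?heap (nim_value H) |\<in>| options p (?heap n)"
            by (auto simp: in_options_stalk_iff)
          with 1 * show ?thesis
            unfolding winN by blast
        next
          case 2
          with 1 * reversible show ?thesis
            by blast
        qed
      next
        case 2
        with IH show ?thesis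
          unfolding winN by blast
      qed
    next
      assume "misere_wins_first p (?heap n + T)"
      then consider H where "H |\<in>| options p (?heap n)" "?loses H"
        | T' where "T' |\<in>| options p T" "\<not> misere_wins_first (opponent p) (?heap n + T')"
        unfolding winN by blast
      then show "misere_wins_first p (G + T)"
      proof cases
        case 1
        then obtain k where "k < n" "H = ?heap k"
          by (auto simp: in_options_stalk_iff)
        with below obtain K where "K |\<in>| A" "H = ?heap (nim_value K)"
          by blast
        with 1 * show ?thesis
          unfolding winG by blast
      next
        case 2
        with IH show ?thesis
          unfolding winG by blast
      qed
    qed
  qed
  then show ?thesis
    by (simp add: misere_equiv_def n_def)
qed

section \<open>Cutting an edge of a shrub\<close>

lemma ground_subset_grounded_verts: "ground P \<subseteq> verts P \<Longrightarrow> ground P \<subseteq> grounded_verts P"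
  by (auto simp: grounded_verts_def)

lemma grounded_verts_step:
  assumes "u \<in> grounded_verts P" "e \<in> edges P" "ends P e = {u, w}" "w \<in> verts P"
  shows "w \<in> grounded_verts P"
proof -
  let ?R = "{(u, w). \<exists>e \<in> edges P. ends P e = {u, w}}"
  obtain g where "g \<in> ground P" "(g, u) \<in> ?R\<^sup>*"
    using assms(1) by (auto simp: grounded_verts_def)
  moreover have "(u, w) \<in> ?R"
    using assms(2,3) by blast
  ultimately show ?thesis
    using assms(4) rtrancl_into_rtrancl[of g u ?R w] unfolding grounded_verts_def by blast
qed

text \<open>A path from the ground visits grounded vertices only, so all its edges survive the
  discarding. Hence one round of discarding suffices to make every remaining vertex grounded, as
  \<open>hackenbush_position\<close> demands.\<close>

lemma grounded_verts_discard_ungrounded: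
  assumes ends: "\<And>e. e \<in> edges P \<Longrightarrow> ends P e \<subseteq> verts P" and ground: "ground P \<subseteq> verts P"
  shows "grounded_verts (discard_ungrounded P) = grounded_verts P"
proof -
  let ?D = "discard_ungrounded P"
  let ?R = "{(u, w). \<exists>e \<in> edges P. ends P e = {u, w}}"
  have D: "verts ?D = grounded_verts P" "ground ?D = ground P" "ends ?D = ends P"
    "edges ?D = {e \<in> edges P. ends P e \<subseteq> grounded_verts P}"
    by (simp_all add: discard_ungrounded_def)
  have "v \<in> grounded_verts ?D" if "(g, v) \<in> ?R\<^sup>*" "g \<in> ground P" for g v
    using that
  proof (induction rule: rtrancl_induct)
    case base
    then show ?case
      using ground_subset_grounded_verts[of ?D] ground_subset_grounded_verts[OF ground] D by auto
  next
    case (step u w)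
    then obtain e where e: "e \<in> edges P" "ends P e = {u, w}"
      by blast
    have u: "u \<in> grounded_verts ?D"
      using step by blast
    then have "u \<in> grounded_verts P"
      using D by (auto simp: grounded_verts_def[of ?D])
    moreover from this e have "w \<in> grounded_verts P"
      by (rule grounded_verts_step) (use e ends[OF e(1)] in simp)
    ultimately have "e \<in> edges ?D" "ends ?D e = {u, w}" "w \<in> verts ?D"
      using e by (simp_all add: D)
    with u show ?case
      by (rule grounded_verts_step)
  qed
  then have "grounded_verts P \<subseteq> grounded_verts ?D"
    unfolding grounded_verts_def[of P] by blast
  moreover have "grounded_verts ?D \<subseteq> grounded_verts P"
    using D by (auto simp: grounded_verts_def[of ?D])
  ultimately show ?thesis
    by blast
qed

lemma cut_edge_simps:
  "ground (cut_edge P e) = ground P" "ends (cut_edge P e) = ends P"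
  "colour_of (cut_edge P e) = colour_of P"
  by (simp_all add: cut_edge_def discard_ungrounded_def)

lemma hackenbush_position_cut_edge:
  assumes "hackenbush_position P"
  shows "hackenbush_position (cut_edge P e)"
proof -
  let ?Q = "P\<lparr>edges := edges P - {e}\<rparr>"
  have fin: "finite (verts P)" "finite (edges P)"
    and ends: "\<And>e. e \<in> edges P \<Longrightarrow> ends P e \<subseteq> verts P \<and> card (ends P e) \<in> {1, 2}"
    and ground: "ground P \<subseteq> verts P"
    using assms by (auto simp: hackenbush_position_def)
  have "grounded_verts (discard_ungrounded ?Q) = grounded_verts ?Q"
    using ends ground by (intro grounded_verts_discard_ungrounded) auto
  moreover have "ground P \<subseteq> grounded_verts ?Q"
    using ground_subset_grounded_verts[of ?Q] ground by simp
  moreover have "finite (grounded_verts ?Q)"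
    using fin by (auto simp: grounded_verts_def)
  ultimately show ?thesis
    using fin ends
    by (auto simp: hackenbush_position_def cut_edge_def discard_ungrounded_def)
qed

text \<open>Every incident edge contributes at least 1, so a total of 1 leaves room for one edge
  only; a loop would contribute 2.\<close>

lemma degree_eq_1D:
  assumes "degree P v = 1" "finite (edges P)"
  obtains e where "{e \<in> edges P. v \<in> ends P e} = {e}" "ends P e \<noteq> {v}"
proof -
  let ?E = "{e \<in> edges P. v \<in> ends P e}"
  define f :: "'b \<Rightarrow> nat" where "f e = (if ends P e = {v} then 2 else 1)" for e
  have "sum f ?E = 1"
    using assms(1) by (simp add: degree_def f_def)
  moreover have "finite ?E"
    using assms(2) by simp
  ultimately obtain a where a: "a \<in> ?E" "f a = 1" "\<And>b. b \<in> ?E \<Longrightarrow> a \<noteq> b \<Longrightarrow> f b = 0"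
    using sum_eq_1_iff[of ?E f] by blast
  have "f b \<noteq> 0" for b
    by (simp add: f_def)
  with a have "?E = {a}"
    by blast
  moreover have "ends P a \<noteq> {v}"
    using a(2) by (auto simp: f_def)
  ultimately show ?thesis
    by (rule that)
qed

text \<open>The edge \<open>e0\<close> is the only one at the root. Without it no path leaves the
  root; with it, both its ends stay grounded, so it survives any other cut and the root keeps degree
  1.\<close>

lemma shrub_cut_edge:
  assumes "shrub S"
  obtains e0 where "e0 \<in> edges S" "edges (cut_edge S e0) = {}"
    "\<And>e. e \<in> edges S \<Longrightarrow> e \<noteq> e0 \<Longrightarrow> shrub (cut_edge S e)"
proof -
  obtain r where r: "ground S = {r}" "degree S r = 1"
    using assms by (auto simp: shrub_def)
  have pos: "hackenbush_position S" and green: "\<And>e. e \<in> edges S \<Longrightarrow> colour_of S e = Green"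
    using assms by (auto simp: shrub_def)
  have fin: "finite (edges S)"
    and ends: "\<And>e. e \<in> edges S \<Longrightarrow> ends S e \<subseteq> verts S \<and> card (ends S e) \<in> {1, 2}"
    and rv: "r \<in> verts S"
    using pos r by (auto simp: hackenbush_position_def)
  obtain e0 where e0: "{e \<in> edges S. r \<in> ends S e} = {e0}" "ends S e0 \<noteq> {r}"
    using degree_eq_1D[OF r(2) fin] .
  have e0E: "e0 \<in> edges S" "r \<in> ends S e0"
    using e0(1) by blast+
  have "v = r" if "v \<in> grounded_verts (S\<lparr>edges := edges S - {e0}\<rparr>)" for v
  proof -
    let ?R = "{(u, w). \<exists>e \<in> edges S - {e0}. ends S e = {u, w}}"
    have "(r, v) \<in> ?R\<^sup>*"
      using that r by (simp add: grounded_verts_def)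
    \<comment> \<open>A nontrivial path would start with an edge at \<open>r\<close> other than
      \<open>e0\<close>.\<close>
    then show ?thesis
    proof (cases rule: converse_rtranclE)
      case (step w)
      then show ?thesis
        using e0(1) by blast
    qed simp
  qed
  then have "edges (cut_edge S e0) \<subseteq> {e \<in> edges S - {e0}. ends S e \<subseteq> {r}}"
    by (auto simp: cut_edge_def discard_ungrounded_def)
  also have "\<dots> = {}"
  proof -
    \<comment> \<open>The cardinality condition rules out empty \<open>ends\<close>, so such an edge
      would be a loop at \<open>r\<close>.\<close>
    have "r \<in> ends S e" if "e \<in> edges S" "ends S e \<subseteq> {r}" for e
      using that ends[OF that(1)] by (auto simp: subset_singleton_iff)
    then show ?thesis
      using e0(1) by blast
  qed
  finally have empty: "edges (cut_edge S e0) = {}"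
    by blast
  have "shrub (cut_edge S e)" if "e \<in> edges S" "e \<noteq> e0" for e
  proof -
    let ?Q = "S\<lparr>edges := edges S - {e}\<rparr>"
    have "card (ends S e0) = 2"
      using ends[OF e0E(1)] e0E(2) e0(2) by (auto simp: card_1_singleton_iff)
    then obtain w where w: "ends S e0 = {r, w}"
      using e0E(2) by (auto simp: card_2_iff doubleton_eq_iff)
    have rQ: "r \<in> grounded_verts ?Q"
      using ground_subset_grounded_verts[of ?Q] r rv by simp
    \<comment> \<open>The uncut edge \<open>e0\<close> itself connects \<open>w\<close> to the
      ground.\<close>
    moreover have "w \<in> grounded_verts ?Q"
    proof (rule grounded_verts_step[OF rQ])
      show "e0 \<in> edges ?Q" "ends ?Q e0 = {r, w}"
        using e0E(1) \<open>e \<noteq> e0\<close> w by simp_all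
      show "w \<in> verts ?Q"
        using ends[OF e0E(1)] w by simp
    qed
    ultimately have "e0 \<in> edges (cut_edge S e)"
      using w e0E(1) \<open>e \<noteq> e0\<close> by (simp add: cut_edge_def discard_ungrounded_def)
    then have "{e' \<in> edges (cut_edge S e). r \<in> ends (cut_edge S e) e'} = {e0}"
      using e0(1) edges_cut_edge[of S e] by (auto simp: cut_edge_simps)
    then have "degree (cut_edge S e) r = 1"
      using e0(2) unfolding degree_def by (simp add: cut_edge_simps)
    moreover have "\<forall>e' \<in> edges (cut_edge S e). colour_of (cut_edge S e) e' = Green"
      using green edges_cut_edge[of S e] by (auto simp: cut_edge_simps)
    ultimately show ?thesis
      using hackenbush_position_cut_edge[OF pos] r by (auto simp: shrub_def cut_edge_simps)
  qed
  with e0E(1) empty show ?thesis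
    by (rule that)
qed

section \<open>Game values of shrubs and the final induction\<close>

lemma hackenbush_game_no_edges:
  assumes "edges P = {}"
  shows "hackenbush_game P = Game {||} {||}"
  using assms by (subst hackenbush_game.simps) (simp add: cuttable_def flip: bot_fset.abs_eq)

text \<open>Both players may cut any green edge, so the two option sets coincide, as the mex rule
  requires.\<close>

lemma hackenbush_game_green:
  assumes "finite (edges P)" "\<And>e. e \<in> edges P \<Longrightarrow> colour_of P e = Green"
  defines "A \<equiv> (\<lambda>e. hackenbush_game (cut_edge P e)) |`| Abs_fset (edges P)"
  shows "hackenbush_game P = Game A A"
proof -
  have "may_cut p Green" for p
    by (cases p) auto
  then have "cuttable p P = edges P" for p
    using assms(2) by (auto simp: cuttable_def)
  with assms(1) show ?thesis
    by (subst hackenbush_game.simps) (simp add: A_def)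
qed

lemma nim_value_zero: "nim_value (Game {||} {||}) = 0"
  by (subst nim_value.simps) simp

lemma hackenbush_game_stalk_0: "hackenbush_game (stalk 0) = Game {||} {||}"
  by (rule hackenbush_game_no_edges) (simp add: stalk_def)

text \<open>Induction on the number of edges, feeding the options to the mex rule. The induction
  hypothesis covers every cut except that of the root edge, whose result has no edges and so is no
  shrub.\<close>

lemma shrub_misere_equiv_stalk:
  assumes "shrub S"
  shows "misere_equiv (hackenbush_game S) (hackenbush_game (stalk (nim_value (hackenbush_game S))))"
  using assms
proof (induction "card (edges S)" arbitrary: S rule: less_induct)
  case less
  have fin: "finite (edges S)" and green: "\<And>e. e \<in> edges S \<Longrightarrow> colour_of S e = Green"
    using less.prems by (auto simp: shrub_def hackenbush_position_def)
  obtain e0 where e0: "e0 \<in> edges S" "edges (cut_edge S e0) = {}"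
    and other: "\<And>e. e \<in> edges S \<Longrightarrow> e \<noteq> e0 \<Longrightarrow> shrub (cut_edge S e)"
    using shrub_cut_edge[OF less.prems] by blast
  define A where "A = (\<lambda>e. hackenbush_game (cut_edge S e)) |`| Abs_fset (edges S)"
  have game: "hackenbush_game S = Game A A"
    unfolding A_def using fin green by (rule hackenbush_game_green)
  have fA: "fset A = (\<lambda>e. hackenbush_game (cut_edge S e)) ` edges S"
    using fin by (simp add: A_def Abs_fset_inverse)
  have root: "hackenbush_game (cut_edge S e0) = Game {||} {||}"
    using e0(2) by (rule hackenbush_game_no_edges)
  show ?case
  proof (rule misere_mex_rule[of _ A])
    fix H
    assume "H |\<in>| A"
    then obtain e where e: "e \<in> edges S" "H = hackenbush_game (cut_edge S e)"
      using fA by blast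
    show "misere_equiv H (hackenbush_game (stalk (nim_value H)))"
    proof (cases "e = e0")
      case True
      \<comment> \<open>The zero game has nim-value 0 and equals the game of the stalk of height
        0.\<close>
      with e root show ?thesis
        by (simp add: nim_value_zero hackenbush_game_stalk_0 misere_equiv_refl)
    next
      case False
      have "card (edges (cut_edge S e)) < card (edges S)"
        using fin e(1) edges_cut_edge[of S e] by (intro psubset_card_mono) auto
      with less.hyps other[OF e(1) False] e(2) show ?thesis
        by blast
    qed
  next
    \<comment> \<open>The cut of the root edge is the option of value 0.\<close>
    show "0 \<in> nim_value ` fset A"
      using root e0(1) unfolding fA by (metis image_eqI nim_value_zero)
  qed (simp_all add: game)
qed

theorem theorem1p1:
  fixes S :: "('v, 'e) hackenbush" and n :: nat and T :: game
  assumes "shrub S"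
    and "n = nim_value (hackenbush_game S)"
  shows "misere_outcome (hackenbush_game S + T) = misere_outcome (hackenbush_game (stalk n) + T)"
  using misere_outcome_cong[OF shrub_misere_equiv_stalk[OF assms(1)]] assms(2) by simp

end
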